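(* Let $\lambda,\sigma_\epsilon>0$. (i) If $U_t$ is TQD, the arbitrageur policy $\psi_t$ is linear, and the assumed trader policy $\hat\pi_t$ is linear, then there exists a linear trader policy $\pi_t$ such that $$\pi_t(x_{t-1},y_{t-1},\phi_{t-1})\in\operatorname*{argmax}_{u_t\in\mathbb{R}}\big(F^{(\psi_t,\hat\pi_t)}_{u_t}U_t\big)(x_{t-1},y_{t-1},\phi_{t-1})$$ for all $x_{t-1},y_{t-1}\in\mathbb{R}$ and all Gaussian $\phi_{t-1}$, so long as the optimization problem is bounded (i.e. the supremum over $u_t$ is finite for all such $x_{t-1},y_{t-1},\phi_{t-1}$). (ii) If $V_t$ is AQD and the trader policy $\pi_t$ is linear, then there exists a linear arbitrageur policy $\psi_t$ such that $$\psi_t(y_{t-1},\phi_{t-1})\in\operatorname*{argmax}_{v_t\in\mathbb{R}}\big(G^{\pi_t}_{v_t}V_t\big)(y_{t-1},\phi_{t-1})$$ for all $y_{t-1}\in\mathbb{R}$ and all Gaussian $\phi_{t-1}$, so long as the optimization problem is bounded (i.e. the supremum over $v_t$ is finite for all such $y_{t-1},\phi_{t-1}$).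
   Context: Setting: a trader with position $x_{t-1}\in\mathbb{R}$ trades $u_t$ at time $t$, so $x_t=x_{t-1}+u_t$; an arbitrageur with position $y_{t-1}\in\mathbb{R}$ trades $v_t$, so $y_t=y_{t-1}+v_t$. The price change is $\Delta p_t=\lambda(u_t+v_t)+\epsilon_t$ with $\epsilon_t\sim N(0,\sigma_\epsilon^2)$ independent of $x_{t-1}$; $\lambda,\sigma_\epsilon>0$ are fixed. The arbitrageur's belief about $x_{t-1}$ is a probability distribution $\phi_{t-1}$ on $\mathbb{R}$. For a belief $\phi_s$, $\mu_s,\sigma_s$ are its mean and standard deviation and $\rho_s=\lambda\sigma_s/\sigma_\epsilon$. Gaussian distributions may be degenerate (point masses, $\sigma_s=0$), and coefficients with superscript $\rho$ are real functions of $\rho\in[0,\infty)$. Bayesian update: if the arbitrageur trades $v_t$, assumes the trader uses policy $\hat\pi_t$, and observes $\Delta p_t$, let $\phi^+_{t-1}$ be the probability measure proportional to $\exp\!\big(-(\Delta p_t-\lambda(\hat\pi_t(x,y_{t-1},\phi_{t-1})+v_t))^2/(2\sigma_\epsilon^2)\big)\phi_{t-1}(dx)$; then the updated belief $\phi_t$ is the image of $\phi^+_{t-1}$ under $x\mapsto x+\hat\pi_t(x,y_{t-1},\phi_{t-1})$. (For $\phi_{t-1}$ Gaussian and $\hat\pi_t$ linear, $\phi_t$ is Gaussian.) Linear policies: a trader policy is linear if $\pi_t(x_{t-1},y_{t-1},\phi_{t-1})=a^{\rho_{t-1}}_{x,t}x_{t-1}+a^{\rho_{t-1}}_{y,t}y_{t-1}+a^{\rho_{t-1}}_{\mu,t}\mu_{t-1}$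 with coefficients that are functions of $\rho_{t-1}$; an arbitrageur policy is linear if $\psi_t(y_{t-1},\phi_{t-1})=b^{\rho_{t-1}}_{y,t}y_{t-1}+b^{\rho_{t-1}}_{\mu,t}\mu_{t-1}$ with coefficients that are functions of $\rho_{t-1}$. Operators. For a trader action $u_t$, an arbitrageur policy $\psi_t$ and an assumed trader policy $\hat\pi_t$, $$\big(F^{(\psi_t,\hat\pi_t)}_{u_t}U\big)(x_{t-1},y_{t-1},\phi_{t-1})=\mathbb{E}\big[\lambda(u_t+v_t)x_{t-1}+U(x_t,y_t,\phi_t)\mid x_{t-1},y_{t-1},\phi_{t-1}\big],$$ where $v_t=\psi_t(y_{t-1},\phi_{t-1})$, $x_t=x_{t-1}+u_t$, $y_t=y_{t-1}+v_t$, and $\phi_t$ is the Bayesian update computed with assumed policy $\hat\pi_t$, arbitrageur trade $v_t$, and $\Delta p_t=\lambda(u_t+v_t)+\epsilon_t$ (the trader actually trades $u_t$; the expectation is over $\epsilon_t$). For an arbitrageur action $v_t$ and a trader policy $\pi_t$, $$\big(G^{\pi_t}_{v_t}V\big)(y_{t-1},\phi_{t-1})=\mathbb{E}\big[\lambda(u_t+v_t)y_{t-1}+V(y_t,\phi_t)\mid y_{t-1},\phi_{t-1}\big],$$ where $x_{t-1}\sim\phi_{t-1}$, $u_t=\pi_t(x_{t-1},y_{t-1},\phi_{t-1})$, $y_t=y_{t-1}+v_t$, and $\phi_t$ is the Bayesian update with (correctly) assumed policy $\pi_t$, arbitrageur trade $v_t$ and $\Delta p_t=\lambda(u_t+v_t)+\epsilon_t$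 (the expectation is over $x_{t-1}$ and $\epsilon_t$). $U_t$ is TQD (trader-quadratic-decomposable) if there are coefficients that are functions of $\rho_t$ such that, for all $x_t,y_t$ and Gaussian $\phi_t$, $$U_t(x_t,y_t,\phi_t)=-\lambda\Big(\tfrac12c^{\rho_t}_{xx,t}x_t^2+\tfrac12c^{\rho_t}_{yy,t}y_t^2+\tfrac12c^{\rho_t}_{\mu\mu,t}\mu_t^2+c^{\rho_t}_{xy,t}x_ty_t+c^{\rho_t}_{x\mu,t}x_t\mu_t+c^{\rho_t}_{y\mu,t}y_t\mu_t-\tfrac{\sigma_\epsilon^2}{\lambda^2}c^{\rho_t}_{0,t}\Big).$$ $V_t$ is AQD (arbitrageur-quadratic-decomposable) if there are coefficients that are functions of $\rho_t$ such that, for all $y_t$ and Gaussian $\phi_t$, $$V_t(y_t,\phi_t)=-\lambda\Big(\tfrac12d^{\rho_t}_{yy,t}y_t^2+\tfrac12d^{\rho_t}_{\mu\mu,t}\mu_t^2+d^{\rho_t}_{y\mu,t}y_t\mu_t-\tfrac{\sigma_\epsilon^2}{\lambda^2}d^{\rho_t}_{0,t}\Big).$$ *)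

theory Defs
  imports "HOL-Probability.Probability"
begin

type_synonym belief = "real measure"
type_synonym trader_policy = "real \<Rightarrow> real \<Rightarrow> belief \<Rightarrow> real"
type_synonym arb_policy = "real \<Rightarrow> belief \<Rightarrow> real"

text \<open>
  Throughout, \<open>lam\<close> is the price impact coefficient and \<open>sig\<close> the standard deviation of the
  price noise. All operators concern a single period; the time index is therefore suppressed.
  Second moments are required to be finite so that mean and standard deviation make sense.
\<close>

definition is_belief :: "belief \<Rightarrow> bool" where
  "is_belief \<phi> \<longleftrightarrow>
     prob_space \<phi> \<and> sets \<phi> = sets borel \<and> integrable \<phi> (\<lambda>x. x\<^sup>2)"

definition gaussian :: "belief \<Rightarrow> bool" where
  "gaussian \<phi> \<longleftrightarrow>
     (\<exists>m. \<phi> = return borel m) \<or>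
     (\<exists>m s. s > 0 \<and> \<phi> = density lborel (\<lambda>x. ennreal (normal_density m s x)))"

definition belief_mean :: "belief \<Rightarrow> real" where
  "belief_mean \<phi> = (\<integral>x. x \<partial>\<phi>)"

definition belief_sd :: "belief \<Rightarrow> real" where
  "belief_sd \<phi> = sqrt (\<integral>x. (x - belief_mean \<phi>)\<^sup>2 \<partial>\<phi>)"

definition belief_rho :: "real \<Rightarrow> real \<Rightarrow> belief \<Rightarrow> real" where
  "belief_rho lam sig \<phi> = lam * belief_sd \<phi> / sig"

definition noise :: "real \<Rightarrow> real measure" where
  "noise sig = density lborel (\<lambda>e. ennreal (normal_density 0 sig e))"

definition likelihood ::
    "real \<Rightarrow> real \<Rightarrow> trader_policy \<Rightarrow> real \<Rightarrow> belief \<Rightarrow> real \<Rightarrow> real \<Rightarrow> real \<Rightarrow> real" where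
  "likelihood lam sig \<pi> y \<phi> v dp x =
     exp (- (dp - lam * (\<pi> x y \<phi> + v))\<^sup>2 / (2 * sig\<^sup>2))"

definition posterior ::
    "real \<Rightarrow> real \<Rightarrow> trader_policy \<Rightarrow> real \<Rightarrow> belief \<Rightarrow> real \<Rightarrow> real \<Rightarrow> belief" where
  "posterior lam sig \<pi> y \<phi> v dp =
     density \<phi> (\<lambda>x. ennreal (likelihood lam sig \<pi> y \<phi> v dp x /
                               (\<integral>z. likelihood lam sig \<pi> y \<phi> v dp z \<partial>\<phi>)))"

definition bayes_update ::
    "real \<Rightarrow> real \<Rightarrow> trader_policy \<Rightarrow> real \<Rightarrow> belief \<Rightarrow> real \<Rightarrow> real \<Rightarrow> belief" where
  "bayes_update lam sig \<pi> y \<phi> v dp =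
     distr (posterior lam sig \<pi> y \<phi> v dp) borel (\<lambda>x. x + \<pi> x y \<phi>)"

definition linear_trader_policy :: "real \<Rightarrow> real \<Rightarrow> trader_policy \<Rightarrow> bool" where
  "linear_trader_policy lam sig \<pi> \<longleftrightarrow>
     (\<exists>ax ay am :: real \<Rightarrow> real. \<forall>x y \<phi>. is_belief \<phi> \<longrightarrow>
        (let r = belief_rho lam sig \<phi> in
         \<pi> x y \<phi> = ax r * x + ay r * y + am r * belief_mean \<phi>))"

definition linear_arb_policy :: "real \<Rightarrow> real \<Rightarrow> arb_policy \<Rightarrow> bool" where
  "linear_arb_policy lam sig \<psi> \<longleftrightarrow>
     (\<exists>by bm :: real \<Rightarrow> real. \<forall>y \<phi>. is_belief \<phi> \<longrightarrow>
        (let r = belief_rho lam sig \<phi> in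
         \<psi> y \<phi> = by r * y + bm r * belief_mean \<phi>))"

text \<open>
  The trader actually trades \<open>u\<close>, whereas the arbitrageur updates as if the trader used \<open>\<pi>\<close>.
  For Gaussian beliefs, linear policies and quadratic-decomposable value functions, the integrands
  of both operators are quadratic polynomials in the Gaussian variables (the updated standard
  deviation is deterministic, the updated mean affine in the price change), so the Bochner
  integrals are genuine expectations.
\<close>

definition F_op ::
    "real \<Rightarrow> real \<Rightarrow> arb_policy \<Rightarrow> trader_policy \<Rightarrow> real \<Rightarrow>
     (real \<Rightarrow> real \<Rightarrow> belief \<Rightarrow> real) \<Rightarrow> real \<Rightarrow> real \<Rightarrow> belief \<Rightarrow> real" where
  "F_op lam sig \<psi> \<pi> u U x y \<phi> =
     (let v = \<psi> y \<phi> in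
      \<integral>e. lam * (u + v) * x +
           U (x + u) (y + v) (bayes_update lam sig \<pi> y \<phi> v (lam * (u + v) + e))
      \<partial>noise sig)"

definition G_op ::
    "real \<Rightarrow> real \<Rightarrow> trader_policy \<Rightarrow> real \<Rightarrow>
     (real \<Rightarrow> belief \<Rightarrow> real) \<Rightarrow> real \<Rightarrow> belief \<Rightarrow> real" where
  "G_op lam sig \<pi> v V y \<phi> =
     (\<integral>(x, e).
        (let u = \<pi> x y \<phi> in
         lam * (u + v) * y +
         V (y + v) (bayes_update lam sig \<pi> y \<phi> v (lam * (u + v) + e)))
      \<partial>(\<phi> \<Otimes>\<^sub>M noise sig))"

definition TQD :: "real \<Rightarrow> real \<Rightarrow> (real \<Rightarrow> real \<Rightarrow> belief \<Rightarrow> real) \<Rightarrow> bool" where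
  "TQD lam sig U \<longleftrightarrow>
     (\<exists>cxx cyy cmm cxy cxm cym c0 :: real \<Rightarrow> real. \<forall>x y \<phi>. gaussian \<phi> \<longrightarrow>
        (let r = belief_rho lam sig \<phi>; m = belief_mean \<phi> in
         U x y \<phi> = - lam *
           (1/2 * cxx r * x\<^sup>2 + 1/2 * cyy r * y\<^sup>2 + 1/2 * cmm r * m\<^sup>2
            + cxy r * x * y + cxm r * x * m + cym r * y * m
            - sig\<^sup>2 / lam\<^sup>2 * c0 r)))"

definition AQD :: "real \<Rightarrow> real \<Rightarrow> (real \<Rightarrow> belief \<Rightarrow> real) \<Rightarrow> bool" where
  "AQD lam sig V \<longleftrightarrow>
     (\<exists>dyy dmm dym d0 :: real \<Rightarrow> real. \<forall>y \<phi>. gaussian \<phi> \<longrightarrow>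
        (let r = belief_rho lam sig \<phi>; m = belief_mean \<phi> in
         V y \<phi> = - lam *
           (1/2 * dyy r * y\<^sup>2 + 1/2 * dmm r * m\<^sup>2 + dym r * y * m
            - sig\<^sup>2 / lam\<^sup>2 * d0 r)))"

end

theory Submission
  imports Defs
begin

text \<open>
  Under a linear trader policy with slope \<open>a\<close> in \<open>x\<close>, a Gaussian belief stays Gaussian: its new
  standard deviation depends only on \<open>\<rho>\<close>, and its new mean is affine in the price change. Hence both
  objectives are quadratic in the action, with a leading coefficient that depends only on \<open>\<rho>\<close> and a
  linear coefficient that is linear in the state and the mean. A quadratic \<open>A u\<^sup>2 + B u + C\<close> bounded
  above attains its maximum at \<open>- B / (2 A)\<close>, which is then a linear policy.
\<close>

text \<open>
  Boundedness forces \<open>A < 0\<close> or \<open>A = B = 0\<close>; in the latter case the maximiser below reads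
  \<open>0 / 0 = 0\<close>, so that no case distinction is needed in the policies.
\<close>
lemma is_arg_max_quadratic:
  fixes f :: "real \<Rightarrow> real"
  assumes f: "\<And>u. f u = A * u\<^sup>2 + B * u + C"
    and bdd: "bdd_above (range f)"
  shows "is_arg_max f (\<lambda>u. u \<in> UNIV) (- B / (2 * A))"
proof -
  obtain M where M: "f u \<le> M" for u
    using bdd by (auto simp: bdd_above_def)
  have "f u \<le> f (- B / (2 * A))" for u
  proof (cases "A = 0")
    case True
    have "B = 0"
    proof (rule ccontr)
      assume "B \<noteq> 0"
      \<comment> \<open>This point solves \<open>B * u + C = M + 1\<close>, so a nonzero slope
        pushes \<open>f\<close> past its bound.\<close>
      then have "f ((M - C + 1) / B) = M + 1"
        using f True by simp
      then show False
        using M[of "(M - C + 1) / B"] by simp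
    qed
    then show ?thesis
      using f True by simp
  next
    case False
    have square: "f w = A * (w + B / (2 * A))\<^sup>2 + (C - B\<^sup>2 / (4 * A))" for w
      using False by (simp add: f field_simps power2_eq_square)
    have "A < 0"
    proof (rule ccontr)
      assume "\<not> A < 0"
      with False have "A > 0" by simp
      \<comment> \<open>The vertex value is at most \<open>M\<close>, so \<open>D\<close> is
        positive. It is the height still to be gained above the vertex to reach
        \<open>M + 1\<close>, and a displacement of \<open>sqrt (D / A)\<close> from the vertex
        gains exactly that.\<close>
      define D where "D = M + 1 - (C - B\<^sup>2 / (4 * A))"
      have "D > 0"
        using M[of "- B / (2 * A)"] square[of "- B / (2 * A)"] by (simp add: D_def)
      have "f (sqrt (D / A) - B / (2 * A)) = M + 1"
        using \<open>A > 0\<close> \<open>D > 0\<close> by (simp add: square) (simp add: D_def)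
      then show False
        using M[of "sqrt (D / A) - B / (2 * A)"] by simp
    qed
    then show ?thesis
      by (simp add: square mult_nonpos_nonneg)
  qed
  then show ?thesis
    by (simp add: is_arg_max_linorder)
qed

text \<open>Fubini, with integrability obtained from the iterated integral of absolute values. It
  yields the joint moments of the independent pair of trader position and price noise from
  one-dimensional moments.\<close>

lemma has_bochner_integral_pair_mult:
  fixes f :: "'a \<Rightarrow> real" and g :: "'b \<Rightarrow> real"
  assumes "sigma_finite_measure M" "sigma_finite_measure N"
    and f: "has_bochner_integral M f a" and g: "has_bochner_integral N g b"
  shows "has_bochner_integral (M \<Otimes>\<^sub>M N) (\<lambda>z. f (fst z) * g (snd z)) (a * b)"
proof -
  interpret pair_sigma_finite M N
    using assms(1,2) by (simp add: pair_sigma_finite_def)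
  have fi: "integrable M f" "integral\<^sup>L M f = a" and gi: "integrable N g" "integral\<^sup>L N g = b"
    using f g by (auto simp: has_bochner_integral_iff)
  note [measurable] = borel_measurable_integrable[OF fi(1)] borel_measurable_integrable[OF gi(1)]
  have int: "integrable (M \<Otimes>\<^sub>M N) (\<lambda>z. f (fst z) * g (snd z))"
    by (rule Fubini_integrable) (auto simp: abs_mult fi gi)
  then have "integral\<^sup>L (M \<Otimes>\<^sub>M N) (\<lambda>z. f (fst z) * g (snd z)) = (\<integral>x. \<integral>e. f x * g e \<partial>N \<partial>M)"
    using integral_fst'[OF int] by simp
  then show ?thesis
    using int by (simp add: has_bochner_integral_iff fi gi)
qed

section \<open>Gaussian beliefs, degenerate ones included, and their moments\<close>

text \<open>Point masses are included as \<open>s = 0\<close>; \<open>normal_density m 0\<close> itself is the zero function.\<close>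
definition normal_belief :: "real \<Rightarrow> real \<Rightarrow> belief" where
  "normal_belief m s =
     (if s = 0 then return borel m else density lborel (\<lambda>x. ennreal (normal_density m s x)))"

text \<open>Merges the two kinds of Gaussian belief into one family indexed by mean and standard
  deviation, so that the optimisation arguments need no case split.\<close>

lemma gaussian_iff: "gaussian \<phi> \<longleftrightarrow> (\<exists>m s. s \<ge> 0 \<and> \<phi> = normal_belief m s)"
proof
  assume "gaussian \<phi>"
  then consider (point) m where "\<phi> = return borel m"
    | (nondegenerate) m s where "s > 0" "\<phi> = density lborel (\<lambda>x. ennreal (normal_density m s x))"
    unfolding gaussian_def by (elim disjE exE conjE)
  then show "\<exists>m s. s \<ge> 0 \<and> \<phi> = normal_belief m s"
  proof cases
    case point
    then show ?thesis
      by (intro exI[of _ m] exI[of _ 0]) (simp add: normal_belief_def)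
  next
    case nondegenerate
    then show ?thesis
      by (intro exI[of _ m] exI[of _ s]) (simp add: normal_belief_def)
  qed
next
  assume "\<exists>m s. s \<ge> 0 \<and> \<phi> = normal_belief m s"
  then obtain m s where "s \<ge> 0" and \<phi>: "\<phi> = normal_belief m s"
    by (elim exE conjE)
  show "gaussian \<phi>"
  proof (cases "s = 0")
    case True
    then show ?thesis
      unfolding gaussian_def by (intro disjI1 exI[of _ m]) (simp add: \<phi> normal_belief_def)
  next
    case False
    with \<open>s \<ge> 0\<close> show ?thesis
      unfolding gaussian_def
      by (intro disjI2 exI[of _ m] exI[of _ s]) (simp add: \<phi> normal_belief_def)
  qed
qed

lemma gaussian_normal_belief: "s \<ge> 0 \<Longrightarrow> gaussian (normal_belief m s)"
  unfolding gaussian_iff by blast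

lemma sets_normal_belief [simp, measurable_cong]: "sets (normal_belief m s) = sets borel"
  by (simp add: normal_belief_def)

lemma space_normal_belief [simp]: "space (normal_belief m s) = UNIV"
  by (simp add: normal_belief_def)

lemma prob_space_normal_belief: "s \<ge> 0 \<Longrightarrow> prob_space (normal_belief m s)"
  by (auto simp: normal_belief_def prob_space_return prob_space_normal_density)

lemma normal_belief_moments:
  assumes "s \<ge> 0"
  shows "has_bochner_integral (normal_belief m s) (\<lambda>x. x - m) 0"
    and "has_bochner_integral (normal_belief m s) (\<lambda>x. (x - m)\<^sup>2) (s\<^sup>2)"
proof -
  have "has_bochner_integral (normal_belief m s) (\<lambda>x. x - m) 0 \<and>
        has_bochner_integral (normal_belief m s) (\<lambda>x. (x - m)\<^sup>2) (s\<^sup>2)"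
  proof (cases "s = 0")
    case True
    have "has_bochner_integral (return borel m) g (g m)"
      if [measurable]: "g \<in> borel_measurable borel" for g :: "real \<Rightarrow> real"
      by (auto simp: has_bochner_integral_iff integral_return integrable_iff_bounded nn_integral_return)
    from this[of "\<lambda>x. x - m"] this[of "\<lambda>x. (x - m)\<^sup>2"] True
    show ?thesis by (simp add: normal_belief_def)
  next
    case False
    with assms have "s > 0" by simp
    with normal_moment_odd[OF this, of m 0] normal_moment_even[OF this, of m 1] show ?thesis
      by (auto simp: normal_belief_def intro!: has_bochner_integral_density)
  qed
  then show "has_bochner_integral (normal_belief m s) (\<lambda>x. x - m) 0"
    and "has_bochner_integral (normal_belief m s) (\<lambda>x. (x - m)\<^sup>2) (s\<^sup>2)"
    by auto
qed

lemma normal_belief_const: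
  assumes "s \<ge> 0"
  shows "has_bochner_integral (normal_belief m s) (\<lambda>x. c :: real) c"
proof -
  interpret prob_space "normal_belief m s"
    using assms by (rule prob_space_normal_belief)
  show ?thesis
    by (simp add: has_bochner_integral_iff prob_space[simplified])
qed

lemma normal_belief_mean:
  assumes "s \<ge> 0"
  shows "has_bochner_integral (normal_belief m s) (\<lambda>x. x) m"
  using has_bochner_integral_add[OF normal_belief_moments(1)[OF assms] normal_belief_const[OF assms, of m m]]
  by simp

lemma normal_belief_second_moment:
  assumes "s \<ge> 0"
  shows "has_bochner_integral (normal_belief m s) (\<lambda>x. x\<^sup>2) (s\<^sup>2 + m\<^sup>2)"
proof -
  have "has_bochner_integral (normal_belief m s)
          (\<lambda>x. (x - m)\<^sup>2 + (2 * m * x - m\<^sup>2)) (s\<^sup>2 + (2 * m * m - m\<^sup>2))"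
    by (intro has_bochner_integral_add has_bochner_integral_diff has_bochner_integral_mult_right
        normal_belief_moments(2) normal_belief_mean normal_belief_const assms)
  then show ?thesis
    by (simp add: power2_eq_square algebra_simps)
qed

lemma belief_mean_normal_belief [simp]: "s \<ge> 0 \<Longrightarrow> belief_mean (normal_belief m s) = m"
  unfolding belief_mean_def by (rule has_bochner_integral_integral_eq[OF normal_belief_mean])

lemma belief_rho_normal_belief [simp]:
  "s \<ge> 0 \<Longrightarrow> belief_rho lam sig (normal_belief m s) = lam * s / sig"
  unfolding belief_rho_def belief_sd_def
  by (simp add: has_bochner_integral_integral_eq[OF normal_belief_moments(2)])

text \<open>Linearity of a policy is stated over all beliefs with finite second moment; this makes
  it applicable at Gaussian beliefs.\<close>

lemma is_belief_normal_belief: "s \<ge> 0 \<Longrightarrow> is_belief (normal_belief m s)"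
  unfolding is_belief_def
  using prob_space_normal_belief has_bochner_integral_iff[THEN iffD1, OF normal_belief_second_moment]
  by auto

section \<open>Affine images and Bayesian updates of Gaussian beliefs\<close>

text \<open>The case \<alpha> = 0 matters: a trader policy with slope -1 in \<open>x\<close>
  liquidates the position, and the updated belief collapses to a point mass.\<close>

lemma distr_normal_belief_affine:
  assumes "s \<ge> 0"
  shows "distr (normal_belief m s) borel (\<lambda>x. \<beta> + \<alpha> * x) = normal_belief (\<beta> + \<alpha> * m) (\<bar>\<alpha>\<bar> * s)"
proof (cases "s = 0 \<or> \<alpha> = 0")
  case True
  interpret prob_space "normal_belief m s"
    using assms by (rule prob_space_normal_belief)
  show ?thesis
  proof (cases "\<alpha> = 0")
    case True
    have "distr (normal_belief m s) borel (\<lambda>x. \<beta>) = return borel \<beta>"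
      by (rule distr_const) simp
    with True show ?thesis by (simp add: normal_belief_def)
  next
    case False
    with True show ?thesis
      by (simp add: normal_belief_def distr_return)
  qed
next
  case False
  with assms have s: "s > 0" and \<alpha>: "\<alpha> \<noteq> 0" by auto
  interpret prob_space "normal_belief m s"
    using assms by (rule prob_space_normal_belief)
  \<comment> \<open>\<open>normal_density_affine\<close> speaks of random variables, so the identity
    is taken as a normal random variable on the belief itself. Its target \<open>lborel\<close> is
    exchanged for \<open>borel\<close> afterwards, as both have the same sets.\<close>
  have "distributed (normal_belief m s) lborel (\<lambda>x. x) (normal_density m s)"
    using s by (auto simp: distributed_def normal_belief_def distr_id2)
  from normal_density_affine[OF this s \<alpha>, of \<beta>]
  have "distr (normal_belief m s) lborel (\<lambda>x. \<beta> + \<alpha> * x)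
      = density lborel (normal_density (\<beta> + \<alpha> * m) (\<bar>\<alpha>\<bar> * s))"
    by (simp add: distributed_def)
  moreover have "distr (normal_belief m s) lborel (\<lambda>x. \<beta> + \<alpha> * x)
      = distr (normal_belief m s) borel (\<lambda>x. \<beta> + \<alpha> * x)"
    by (rule distr_cong) auto
  ultimately show ?thesis
    using s \<alpha> by (simp add: normal_belief_def)
qed

text \<open>Completing the square in \<open>x\<close> for a signal \<open>w\<close> equal to
  \<open>t * x\<close> plus noise of variance \<open>sig^2\<close>. Precisions add, so the posterior
  precision is \<open>1 / s^2 + t^2 / sig^2 = D / s^2\<close>, and \<open>m'\<close> is the
  precision-weighted mean. The factor free of \<open>x\<close> is, up to normalisation, the marginal
  density of \<open>w\<close>, whose variance is \<open>sig^2 * D\<close>.\<close>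

lemma likelihood_times_normal_density:
  fixes s sig t m w x :: real
  assumes "s > 0" "sig > 0"
  defines "D \<equiv> 1 + t\<^sup>2 * s\<^sup>2 / sig\<^sup>2"
  defines "m' \<equiv> (m + t * s\<^sup>2 / sig\<^sup>2 * w) / D"
  shows "exp (- (w - t * x)\<^sup>2 / (2 * sig\<^sup>2)) * normal_density m s x
       = exp (- (w - t * m)\<^sup>2 / (2 * sig\<^sup>2 * D)) / sqrt D * normal_density m' (s / sqrt D) x"
proof -
  have D: "D > 0"
    unfolding D_def by (simp add: add_pos_nonneg)
  have sD: "sig\<^sup>2 * D = sig\<^sup>2 + t\<^sup>2 * s\<^sup>2"
    using assms(2) by (simp add: D_def field_simps)
  define q where "q = sig\<^sup>2"
  define p where "p = s\<^sup>2"
  have pq: "p > 0" "q > 0" using assms by (auto simp: p_def q_def)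
  have Deq: "D = (q + t\<^sup>2 * p) / q"
    using pq by (simp add: D_def q_def[symmetric] p_def[symmetric] field_simps)
  have E: "q + t\<^sup>2 * p > 0" using pq by (simp add: add_pos_nonneg)
  have m': "m' = (m * q + t * p * w) / (q + t\<^sup>2 * p)"
  proof -
    have "m + t * s\<^sup>2 / sig\<^sup>2 * w = (m * q + t * p * w) / q"
      using pq by (simp add: q_def[symmetric] p_def[symmetric] field_simps)
    then show ?thesis
      using pq by (simp add: m'_def Deq)
  qed
  \<comment> \<open>The identity of exponents, written in the variances \<open>p\<close> and
    \<open>q\<close>; after clearing denominators it is polynomial.\<close>
  have "(w - t * x)\<^sup>2 / (2 * q) + (x - m)\<^sup>2 / (2 * p)
      = (w - t * m)\<^sup>2 / (2 * (q + t\<^sup>2 * p)) + (x - m')\<^sup>2 * (q + t\<^sup>2 * p) / (2 * p * q)"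
  proof -
    have "x - m' = (x * (q + t\<^sup>2 * p) - (m * q + t * p * w)) / (q + t\<^sup>2 * p)"
      unfolding m' using E by (simp add: field_simps)
    then have *: "(x - m')\<^sup>2 * (q + t\<^sup>2 * p) / (2 * p * q)
       = (x * (q + t\<^sup>2 * p) - (m * q + t * p * w))\<^sup>2 / ((q + t\<^sup>2 * p) * (2 * p * q))"
      using E pq by (simp add: power2_eq_square)
    show ?thesis
      unfolding * using E pq
      by (simp add: divide_simps) (simp add: power2_eq_square algebra_simps)
  qed
  moreover have "(x - m')\<^sup>2 * (q + t\<^sup>2 * p) / (2 * p * q) = (x - m')\<^sup>2 / (2 * (s / sqrt D)\<^sup>2)"
    using D pq by (simp add: power_divide p_def[symmetric]) (simp add: Deq)
  moreover have "2 * (q + t\<^sup>2 * p) = 2 * sig\<^sup>2 * D"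
    using sD by (simp add: q_def p_def)
  ultimately have "- (w - t * x)\<^sup>2 / (2 * sig\<^sup>2) + - (x - m)\<^sup>2 / (2 * s\<^sup>2)
     = - (w - t * m)\<^sup>2 / (2 * sig\<^sup>2 * D) + - (x - m')\<^sup>2 / (2 * (s / sqrt D)\<^sup>2)"
    by (simp add: q_def p_def)
  then have "exp (- (w - t * x)\<^sup>2 / (2 * sig\<^sup>2)) * exp (- (x - m)\<^sup>2 / (2 * s\<^sup>2))
     = exp (- (w - t * m)\<^sup>2 / (2 * sig\<^sup>2 * D)) * exp (- (x - m')\<^sup>2 / (2 * (s / sqrt D)\<^sup>2))"
    by (simp only: exp_add[symmetric])
  \<comment> \<open>The normalising constants of prior and posterior differ by
    \<open>sqrt D\<close>, which the prefactor \<open>1 / sqrt D\<close> compensates.\<close>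
  moreover have "sqrt (2 * pi * (s / sqrt D)\<^sup>2) * sqrt D = sqrt (2 * pi * s\<^sup>2)"
    using D assms by (simp add: real_sqrt_mult real_sqrt_divide power_divide)
  ultimately show ?thesis
    unfolding normal_density_def using D by (simp add: field_simps)
qed


text \<open>Removing the predictable part \<open>lam * (k + v)\<close> from the price change leaves,
  from the arbitrageur's viewpoint, a noisy signal of \<open>lam * a * x\<close>. The preceding
  computation applies with \<open>t = lam * a\<close>.\<close>

lemma posterior_normal_belief:
  fixes lam sig a k m s :: real
  assumes s: "s \<ge> 0" and sig: "sig > 0"
    and lin: "\<And>x. \<pi> x y (normal_belief m s) = a * x + k"
  defines "D \<equiv> 1 + (lam * a)\<^sup>2 * s\<^sup>2 / sig\<^sup>2"
  shows "posterior lam sig \<pi> y (normal_belief m s) v dp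
       = normal_belief ((m + lam * a * s\<^sup>2 / sig\<^sup>2 * (dp - lam * (k + v))) / D) (s / sqrt D)"
proof -
  define w where "w = dp - lam * (k + v)"
  define L where "L = (\<lambda>x. exp (- (w - lam * a * x)\<^sup>2 / (2 * sig\<^sup>2)))"
  have L: "likelihood lam sig \<pi> y (normal_belief m s) v dp = L"
    by (simp add: fun_eq_iff likelihood_def lin L_def w_def algebra_simps)
  have [measurable]: "L \<in> borel_measurable borel"
    unfolding L_def by measurable
  have D: "D > 0"
    unfolding D_def by (simp add: add_pos_nonneg)
  define m' where "m' = (m + lam * a * s\<^sup>2 / sig\<^sup>2 * w) / D"
  have "density (normal_belief m s) (\<lambda>x. ennreal (L x / (\<integral>z. L z \<partial>normal_belief m s)))
      = normal_belief m' (s / sqrt D)"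
  proof (cases "s = 0")
    case True
    have "L m > 0" by (simp add: L_def)
    \<comment> \<open>At a point mass the likelihood cancels against its normaliser, so the belief
      is not revised.\<close>
    have "density (return borel m) (\<lambda>x. ennreal (L x / L m)) = density (return borel m) (\<lambda>x. 1)"
      by (rule density_cong) (use \<open>L m > 0\<close> in \<open>auto simp: AE_return\<close>)
    moreover have "m' = m" using True by (simp add: m'_def D_def)
    ultimately show ?thesis
      using True by (simp add: normal_belief_def integral_return density_1)
  next
    case False
    with s have s0: "s > 0" by simp
    define C where "C = exp (- (w - lam * a * m)\<^sup>2 / (2 * sig\<^sup>2 * D)) / sqrt D"
    have "C > 0" using D by (simp add: C_def)
    have LC: "L x * normal_density m s x = C * normal_density m' (s / sqrt D) x" for x
      unfolding L_def C_def m'_def D_def by (rule likelihood_times_normal_density[OF s0 sig])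
    have \<phi>: "normal_belief m s = density lborel (\<lambda>x. ennreal (normal_density m s x))"
      using False by (simp add: normal_belief_def)
    have "(\<integral>z. L z \<partial>normal_belief m s) = (\<integral>z. L z * normal_density m s z \<partial>lborel)"
      by (simp add: \<phi> integral_density mult.commute)
    \<comment> \<open>What remains beside the constant is a Gaussian density of total mass one, so
      the normaliser is \<open>C\<close>.\<close>
    also have "\<dots> = C"
      using s0 D by (simp add: LC)
    finally have "(\<integral>z. L z \<partial>normal_belief m s) = C" .
    moreover have "density (normal_belief m s) (\<lambda>x. ennreal (L x / C))
        = density lborel (\<lambda>x. ennreal (normal_density m s x) * ennreal (L x / C))"
      unfolding \<phi> by (rule density_density_eq) auto
    moreover have "ennreal (normal_density m s x) * ennreal (L x / C)
        = ennreal (normal_density m' (s / sqrt D) x)" for x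
      using LC[of x] \<open>C > 0\<close> by (simp add: ennreal_mult'[symmetric] L_def field_simps)
    ultimately show ?thesis
      using s0 D by (simp add: normal_belief_def)
  qed
  then show ?thesis
    unfolding posterior_def L m'_def w_def .
qed

text \<open>The arbitrageur's own trade \<open>v\<close> cancels from the price surprise, which
  equals \<open>lam * (u - k) + e\<close>. Hence \<open>v\<close> does not enter the new belief, the
  new mean is affine in \<open>u\<close> and \<open>e\<close>, and the new standard deviation
  involves neither. The actual trade \<open>u\<close> is left arbitrary: it covers both a trader
  deviating from the assumed policy and one who follows it.\<close>

lemma bayes_update_normal_belief:
  fixes lam sig a k m s :: real
  assumes s: "s \<ge> 0" and sig: "sig > 0" and lam: "lam > 0"
    and lin: "\<And>x. \<pi> x y (normal_belief m s) = a * x + k"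
  defines "r \<equiv> lam * s / sig"
  shows "bayes_update lam sig \<pi> y (normal_belief m s) v (lam * (u + v) + e)
       = normal_belief
           (k + (1 + a) * ((m + a * r\<^sup>2 * (u - k + e / lam)) / (1 + a\<^sup>2 * r\<^sup>2)))
           (\<bar>1 + a\<bar> * (s / sqrt (1 + a\<^sup>2 * r\<^sup>2)))"
proof -
  have D: "1 + (lam * a)\<^sup>2 * s\<^sup>2 / sig\<^sup>2 = 1 + a\<^sup>2 * r\<^sup>2"
    by (simp add: r_def power_mult_distrib power_divide)
  have gain: "lam * a * s\<^sup>2 / sig\<^sup>2 * (lam * (u + v) + e - lam * (k + v)) = a * r\<^sup>2 * (u - k + e / lam)"
    using lam sig by (simp add: r_def power2_eq_square field_simps)
  have post: "posterior lam sig \<pi> y (normal_belief m s) v (lam * (u + v) + e)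
      = normal_belief ((m + a * r\<^sup>2 * (u - k + e / lam)) / (1 + a\<^sup>2 * r\<^sup>2)) (s / sqrt (1 + a\<^sup>2 * r\<^sup>2))"
    using posterior_normal_belief[where \<pi> = \<pi> and y = y and lam = lam and v = v
        and dp = "lam * (u + v) + e", OF s sig lin]
    unfolding D gain .
  have "(\<lambda>x. x + \<pi> x y (normal_belief m s)) = (\<lambda>x. k + (1 + a) * x)"
    by (simp add: fun_eq_iff lin algebra_simps)
  then show ?thesis
    unfolding bayes_update_def post using s
    by (simp add: distr_normal_belief_affine)
qed

section \<open>Expectations of quadratics in Gaussian variables\<close>

lemma noise_eq_normal_belief: "sig > 0 \<Longrightarrow> noise sig = normal_belief 0 sig"
  by (simp add: noise_def normal_belief_def)

text \<open>The argument \<open>p + q * e\<close> stands for the updated mean, and the coefficients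
  for the objective sorted by powers of it. Noise only adds the variance term
  \<open>q^2 * s^2\<close>.\<close>

lemma integral_normal_belief_quadratic:
  assumes "s \<ge> 0"
  shows "(\<integral>e. c\<^sub>0 + c\<^sub>1 * (p + q * e) + c\<^sub>2 * (p + q * e)\<^sup>2 \<partial>normal_belief 0 s)
       = c\<^sub>0 + c\<^sub>1 * p + c\<^sub>2 * p\<^sup>2 + c\<^sub>2 * q\<^sup>2 * s\<^sup>2"
proof -
  have "has_bochner_integral (normal_belief 0 s)
      (\<lambda>e. (c\<^sub>0 + c\<^sub>1 * p + c\<^sub>2 * p\<^sup>2) + (c\<^sub>1 * q + 2 * c\<^sub>2 * p * q) * e + c\<^sub>2 * q\<^sup>2 * e\<^sup>2)
      ((c\<^sub>0 + c\<^sub>1 * p + c\<^sub>2 * p\<^sup>2) + (c\<^sub>1 * q + 2 * c\<^sub>2 * p * q) * 0 + c\<^sub>2 * q\<^sup>2 * (s\<^sup>2 + 0\<^sup>2))"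
    by (intro has_bochner_integral_add has_bochner_integral_mult_right
        normal_belief_mean normal_belief_second_moment normal_belief_const assms)
  from has_bochner_integral_integral_eq[OF this] show ?thesis
    by (simp add: power2_eq_square algebra_simps)
qed

text \<open>By independence the variance of the updated mean is
  \<open>q^2 * s^2 + h^2 * t^2\<close>. The separate term in \<open>fst z\<close> takes up the price
  impact of the trader's random trade.\<close>

lemma integral_pair_normal_belief_quadratic:
  assumes s: "s \<ge> 0" and t: "t \<ge> 0"
  shows "(\<integral>z. c\<^sub>0 + g * fst z + c\<^sub>1 * (p + q * fst z + h * snd z) + c\<^sub>2 * (p + q * fst z + h * snd z)\<^sup>2
            \<partial>(normal_belief m s \<Otimes>\<^sub>M normal_belief 0 t))
       = c\<^sub>0 + g * m + c\<^sub>1 * (p + q * m) + c\<^sub>2 * ((p + q * m)\<^sup>2 + q\<^sup>2 * s\<^sup>2 + h\<^sup>2 * t\<^sup>2)"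
proof -
  have sf: "sigma_finite_measure (normal_belief m s)" "sigma_finite_measure (normal_belief 0 t)"
    using prob_space_normal_belief[OF s] prob_space_normal_belief[OF t]
    by (simp_all add: prob_space_imp_sigma_finite)
  note mult = has_bochner_integral_pair_mult[OF sf]
  note x0 = normal_belief_const[OF s, of m 1] and x1 = normal_belief_mean[OF s, of m]
    and x2 = normal_belief_second_moment[OF s, of m]
  note e0 = normal_belief_const[OF t, of 0 1] and e1 = normal_belief_mean[OF t, of 0]
    and e2 = normal_belief_second_moment[OF t, of 0]
  let ?M = "normal_belief m s \<Otimes>\<^sub>M normal_belief 0 t"
  have i0: "has_bochner_integral ?M (\<lambda>z. 1 :: real) 1" using mult[OF x0 e0] by simp
  have i10: "has_bochner_integral ?M fst m" using mult[OF x1 e0] by simp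
  have i20: "has_bochner_integral ?M (\<lambda>z. (fst z)\<^sup>2) (s\<^sup>2 + m\<^sup>2)" using mult[OF x2 e0] by simp
  have i01: "has_bochner_integral ?M snd 0" using mult[OF x0 e1] by simp
  have i02: "has_bochner_integral ?M (\<lambda>z. (snd z)\<^sup>2) (t\<^sup>2)" using mult[OF x0 e2] by simp
  have i11: "has_bochner_integral ?M (\<lambda>z. fst z * snd z) 0" using mult[OF x1 e1] by simp
  have "has_bochner_integral ?M
      (\<lambda>z. (c\<^sub>0 + c\<^sub>1 * p + c\<^sub>2 * p\<^sup>2) * 1 + (g + c\<^sub>1 * q + 2 * c\<^sub>2 * p * q) * fst z
         + (c\<^sub>1 * h + 2 * c\<^sub>2 * p * h) * snd z + (c\<^sub>2 * q\<^sup>2) * (fst z)\<^sup>2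
         + (2 * c\<^sub>2 * q * h) * (fst z * snd z) + (c\<^sub>2 * h\<^sup>2) * (snd z)\<^sup>2)
      ((c\<^sub>0 + c\<^sub>1 * p + c\<^sub>2 * p\<^sup>2) * 1 + (g + c\<^sub>1 * q + 2 * c\<^sub>2 * p * q) * m
         + (c\<^sub>1 * h + 2 * c\<^sub>2 * p * h) * 0 + (c\<^sub>2 * q\<^sup>2) * (s\<^sup>2 + m\<^sup>2)
         + (2 * c\<^sub>2 * q * h) * 0 + (c\<^sub>2 * h\<^sup>2) * t\<^sup>2)"
    by (intro has_bochner_integral_add has_bochner_integral_mult_right i0 i10 i20 i01 i02 i11)
  from has_bochner_integral_integral_eq[OF this] show ?thesis
    by (simp add: power2_eq_square algebra_simps)
qed

theorem theorem4:
  fixes lam sig :: real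
  assumes "lam > 0" and "sig > 0"
  shows
    "(\<forall>U \<psi> \<pi>'.
        TQD lam sig U \<longrightarrow> linear_arb_policy lam sig \<psi> \<longrightarrow> linear_trader_policy lam sig \<pi>' \<longrightarrow>
        (\<forall>x y \<phi>. gaussian \<phi> \<longrightarrow> bdd_above (range (\<lambda>u. F_op lam sig \<psi> \<pi>' u U x y \<phi>))) \<longrightarrow>
        (\<exists>\<pi>. linear_trader_policy lam sig \<pi> \<and>
           (\<forall>x y \<phi>. gaussian \<phi> \<longrightarrow>
              is_arg_max (\<lambda>u. F_op lam sig \<psi> \<pi>' u U x y \<phi>) (\<lambda>u. u \<in> UNIV) (\<pi> x y \<phi>))))
   \<and> (\<forall>V \<pi>.
        AQD lam sig V \<longrightarrow> linear_trader_policy lam sig \<pi> \<longrightarrow>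
        (\<forall>y \<phi>. gaussian \<phi> \<longrightarrow> bdd_above (range (\<lambda>v. G_op lam sig \<pi> v V y \<phi>))) \<longrightarrow>
        (\<exists>\<psi>. linear_arb_policy lam sig \<psi> \<and>
           (\<forall>y \<phi>. gaussian \<phi> \<longrightarrow>
              is_arg_max (\<lambda>v. G_op lam sig \<pi> v V y \<phi>) (\<lambda>v. v \<in> UNIV) (\<psi> y \<phi>))))"
proof (intro conjI allI impI)

  \<comment> \<open>The trader's problem\<close>
  fix U \<psi> \<pi>'
  assume "TQD lam sig U" and "linear_arb_policy lam sig \<psi>" and "linear_trader_policy lam sig \<pi>'"
    and bdd: "\<forall>x y \<phi>. gaussian \<phi> \<longrightarrow> bdd_above (range (\<lambda>u. F_op lam sig \<psi> \<pi>' u U x y \<phi>))"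
  obtain cxx cyy cmm cxy cxm cym c0 where "\<forall>x y \<phi>. gaussian \<phi> \<longrightarrow>
        (let r = belief_rho lam sig \<phi>; m = belief_mean \<phi> in
         U x y \<phi> = - lam *
           (1/2 * cxx r * x\<^sup>2 + 1/2 * cyy r * y\<^sup>2 + 1/2 * cmm r * m\<^sup>2
            + cxy r * x * y + cxm r * x * m + cym r * y * m
            - sig\<^sup>2 / lam\<^sup>2 * c0 r))"
    using \<open>TQD lam sig U\<close> unfolding TQD_def by (elim exE)
  then have U: "U x y (normal_belief m s) = (let r = lam * s / sig in - lam *
           (1/2 * cxx r * x\<^sup>2 + 1/2 * cyy r * y\<^sup>2 + 1/2 * cmm r * m\<^sup>2
            + cxy r * x * y + cxm r * x * m + cym r * y * m
            - sig\<^sup>2 / lam\<^sup>2 * c0 r))" if "s \<ge> 0" for x y m s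
    using that by (simp add: Let_def gaussian_normal_belief)
  obtain b\<^sub>y bm where "\<forall>y \<phi>. is_belief \<phi> \<longrightarrow>
      (let r = belief_rho lam sig \<phi> in \<psi> y \<phi> = b\<^sub>y r * y + bm r * belief_mean \<phi>)"
    using \<open>linear_arb_policy lam sig \<psi>\<close> unfolding linear_arb_policy_def by (elim exE)
  then have \<psi>: "\<psi> y (normal_belief m s) = b\<^sub>y (lam * s / sig) * y + bm (lam * s / sig) * m"
    if "s \<ge> 0" for y m s
    using that is_belief_normal_belief by (simp add: Let_def)
  obtain ax ay am where "\<forall>x y \<phi>. is_belief \<phi> \<longrightarrow>
      (let r = belief_rho lam sig \<phi> in \<pi>' x y \<phi> = ax r * x + ay r * y + am r * belief_mean \<phi>)"
    using \<open>linear_trader_policy lam sig \<pi>'\<close> unfolding linear_trader_policy_def by (elim exE)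
  then have \<pi>': "\<pi>' x y (normal_belief m s)
      = ax (lam * s / sig) * x + ay (lam * s / sig) * y + am (lam * s / sig) * m"
    if "s \<ge> 0" for x y m s
    using that is_belief_normal_belief by (simp add: Let_def)
  define D where "D r = 1 + (ax r)\<^sup>2 * r\<^sup>2" for r
  \<comment> \<open>\<open>r'\<close> is the updated \<rho>. Below, the updated mean is
    \<open>p + q * u + q / lam * e\<close>, \<open>y'\<close> is the arbitrageur's new position, and
    \<open>A\<close>, \<open>B\<close> are the coefficients of \<open>u^2\<close> and
    \<open>u\<close> in the objective.\<close>
  define r' where "r' r = \<bar>1 + ax r\<bar> * (r / sqrt (D r))" for r
  define q where "q r = (1 + ax r) * ax r * r\<^sup>2 / D r" for r
  define p where "p r y m = (1 + ax r) / D r * m + (1 - q r) * (ay r * y + am r * m)" for r y m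
  define y' where "y' r y m = y + (b\<^sub>y r * y + bm r * m)" for r y m
  define A where "A r = - lam * (cxx (r' r) / 2 + cmm (r' r) * (q r)\<^sup>2 / 2 + cxm (r' r) * q r)" for r
  define B where "B r x y m = lam * x - lam * (cxx (r' r) * x + cmm (r' r) * p r y m * q r
      + cxy (r' r) * y' r y m + cxm (r' r) * (p r y m + q r * x) + cym (r' r) * y' r y m * q r)"
    for r x y m
  define \<pi> where "\<pi> x y \<phi> = - B (belief_rho lam sig \<phi>) x y (belief_mean \<phi>) / (2 * A (belief_rho lam sig \<phi>))"
    for x y \<phi>
  \<comment> \<open>Linearity lets the values of \<open>B\<close> at the unit vectors serve as
    policy coefficients, after division by \<open>- 2 * A r\<close>.\<close>
  have B_linear: "B r x y m = B r 1 0 0 * x + B r 0 1 0 * y + B r 0 0 1 * m" for r x y m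
    by (simp add: B_def p_def y'_def algebra_simps)
  have "linear_trader_policy lam sig \<pi>"
    unfolding linear_trader_policy_def
  proof (intro exI allI impI)
    fix x y \<phi>
    show "let r = belief_rho lam sig \<phi> in
         \<pi> x y \<phi> = (- B r 1 0 0 / (2 * A r)) * x + (- B r 0 1 0 / (2 * A r)) * y
           + (- B r 0 0 1 / (2 * A r)) * belief_mean \<phi>"
      unfolding Let_def \<pi>_def
      by (subst B_linear) (simp add: add_divide_distrib diff_divide_distrib)
  qed
  moreover have "is_arg_max (\<lambda>u. F_op lam sig \<psi> \<pi>' u U x y \<phi>) (\<lambda>u. u \<in> UNIV) (\<pi> x y \<phi>)"
    if gauss: "gaussian \<phi>" for x y \<phi>
  proof -
    obtain m s where s: "s \<ge> 0" and \<phi>: "\<phi> = normal_belief m s"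
      using gauss unfolding gaussian_iff by blast
    define r where "r = lam * s / sig"
    define v where "v = b\<^sub>y r * y + bm r * m"
    define k where "k = ay r * y + am r * m"
    have "D r > 0" by (simp add: D_def add_pos_nonneg)
    have upd: "bayes_update lam sig \<pi>' y \<phi> v (lam * (u + v) + e)
        = normal_belief ((p r y m + q r * u) + q r / lam * e) (\<bar>1 + ax r\<bar> * (s / sqrt (D r)))" for u e
    proof -
      have "k + (1 + ax r) * ((m + ax r * r\<^sup>2 * (u - k + e / lam)) / D r)
          = (p r y m + q r * u) + q r / lam * e"
        using \<open>D r > 0\<close> \<open>lam > 0\<close> unfolding p_def q_def k_def[symmetric]
        by (simp add: field_simps)
      then show ?thesis
        using bayes_update_normal_belief[where \<pi> = \<pi>' and y = y and m = m and a = "ax r" and k = k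
            and v = v and u = u and e = e, OF s \<open>sig > 0\<close> \<open>lam > 0\<close>]
        by (simp add: \<phi> \<pi>'[OF s] r_def[symmetric] k_def D_def[symmetric])
    qed
    have r': "lam * (\<bar>1 + ax r\<bar> * (s / sqrt (D r))) / sig = r' r"
      by (simp add: r'_def r_def ac_simps)
    have s': "\<bar>1 + ax r\<bar> * (s / sqrt (D r)) \<ge> 0"
      using s \<open>D r > 0\<close> by simp
    \<comment> \<open>All terms free of \<open>u\<close>, including the contribution of the noise
      variance through the squared updated mean.\<close>
    define K where "K = lam * v * x - lam * (cxx (r' r) * x\<^sup>2 / 2 + cyy (r' r) * (y' r y m)\<^sup>2 / 2
        + cmm (r' r) * ((p r y m)\<^sup>2 + (q r / lam)\<^sup>2 * sig\<^sup>2) / 2 + cxy (r' r) * x * y' r y m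
        + cxm (r' r) * x * p r y m + cym (r' r) * y' r y m * p r y m
        - sig\<^sup>2 / lam\<^sup>2 * c0 (r' r))"
    have "F_op lam sig \<psi> \<pi>' u U x y \<phi> = A r * u\<^sup>2 + B r x y m * u + K" for u
    proof -
      \<comment> \<open>The integrand sorted by powers of the updated mean; \<open>h0\<close> and
        \<open>h1\<close> still contain \<open>u\<close>.\<close>
      define h0 where "h0 = lam * (u + v) * x - lam * (1/2 * cxx (r' r) * (x + u)\<^sup>2
          + 1/2 * cyy (r' r) * (y' r y m)\<^sup>2 + cxy (r' r) * (x + u) * y' r y m
          - sig\<^sup>2 / lam\<^sup>2 * c0 (r' r))"
      define h1 where "h1 = - lam * (cxm (r' r) * (x + u) + cym (r' r) * y' r y m)"
      define h2 where "h2 = - lam * (1/2 * cmm (r' r))"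
      have v: "\<psi> y \<phi> = v"
        by (simp add: \<phi> \<psi>[OF s] v_def r_def)
      have y': "y + v = y' r y m"
        by (simp add: y'_def v_def)
      have "F_op lam sig \<psi> \<pi>' u U x y \<phi>
          = (\<integral>e. h0 + h1 * ((p r y m + q r * u) + q r / lam * e)
               + h2 * ((p r y m + q r * u) + q r / lam * e)\<^sup>2 \<partial>normal_belief 0 sig)"
        unfolding F_op_def v Let_def upd y' U[OF s'] r' noise_eq_normal_belief[OF \<open>sig > 0\<close>]
        by (rule Bochner_Integration.integral_cong)
          (simp_all add: h0_def h1_def h2_def algebra_simps)
      also have "\<dots> = h0 + h1 * (p r y m + q r * u) + h2 * (p r y m + q r * u)\<^sup>2
          + h2 * (q r / lam)\<^sup>2 * sig\<^sup>2"
        using \<open>sig > 0\<close> by (intro integral_normal_belief_quadratic) simp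
      also have "\<dots> = A r * u\<^sup>2 + B r x y m * u + K"
        by (simp add: h0_def h1_def h2_def K_def A_def B_def power2_eq_square add_divide_distrib algebra_simps)
      finally show ?thesis .
    qed
    from is_arg_max_quadratic[OF this] bdd gauss show ?thesis
      using s by (simp add: \<pi>_def \<phi> r_def)
  qed
  ultimately show "\<exists>\<pi>. linear_trader_policy lam sig \<pi> \<and>
           (\<forall>x y \<phi>. gaussian \<phi> \<longrightarrow>
              is_arg_max (\<lambda>u. F_op lam sig \<psi> \<pi>' u U x y \<phi>) (\<lambda>u. u \<in> UNIV) (\<pi> x y \<phi>))"
    by blast
next

  \<comment> \<open>The arbitrageur's problem\<close>
  fix V \<pi>
  assume "AQD lam sig V" and "linear_trader_policy lam sig \<pi>"
    and bdd: "\<forall>y \<phi>. gaussian \<phi> \<longrightarrow> bdd_above (range (\<lambda>v. G_op lam sig \<pi> v V y \<phi>))"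
  obtain dyy dmm dym d0 where "\<forall>y \<phi>. gaussian \<phi> \<longrightarrow>
        (let r = belief_rho lam sig \<phi>; m = belief_mean \<phi> in
         V y \<phi> = - lam *
           (1/2 * dyy r * y\<^sup>2 + 1/2 * dmm r * m\<^sup>2 + dym r * y * m - sig\<^sup>2 / lam\<^sup>2 * d0 r))"
    using \<open>AQD lam sig V\<close> unfolding AQD_def by (elim exE)
  then have V: "V y (normal_belief m s) = (let r = lam * s / sig in - lam *
           (1/2 * dyy r * y\<^sup>2 + 1/2 * dmm r * m\<^sup>2 + dym r * y * m - sig\<^sup>2 / lam\<^sup>2 * d0 r))"
    if "s \<ge> 0" for y m s
    using that by (simp add: Let_def gaussian_normal_belief)
  obtain ax ay am where "\<forall>x y \<phi>. is_belief \<phi> \<longrightarrow>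
      (let r = belief_rho lam sig \<phi> in \<pi> x y \<phi> = ax r * x + ay r * y + am r * belief_mean \<phi>)"
    using \<open>linear_trader_policy lam sig \<pi>\<close> unfolding linear_trader_policy_def by (elim exE)
  then have \<pi>: "\<pi> x y (normal_belief m s)
      = ax (lam * s / sig) * x + ay (lam * s / sig) * y + am (lam * s / sig) * m"
    if "s \<ge> 0" for x y m s
    using that is_belief_normal_belief by (simp add: Let_def)
  define D where "D r = 1 + (ax r)\<^sup>2 * r\<^sup>2" for r
  define r' where "r' r = \<bar>1 + ax r\<bar> * (r / sqrt (D r))" for r
  \<comment> \<open>Only \<open>dyy\<close> contributes to the curvature: the updated belief does
    not depend on \<open>v\<close>, so \<open>dmm\<close> enters the constant term alone.\<close>
  define A where "A r = - lam * dyy (r' r) / 2" for r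
  \<comment> \<open>By the tower property the expected updated mean is the expectation of \<open>x + \<pi> x\<close>.\<close>
  define B where "B r y m = lam * y - lam * (dyy (r' r) * y
      + dym (r' r) * ((1 + ax r) * m + (ay r * y + am r * m)))" for r y m
  define \<psi> where "\<psi> y \<phi> = - B (belief_rho lam sig \<phi>) y (belief_mean \<phi>) / (2 * A (belief_rho lam sig \<phi>))"
    for y \<phi>
  have B_linear: "B r y m = B r 1 0 * y + B r 0 1 * m" for r y m
    by (simp add: B_def algebra_simps)
  have "linear_arb_policy lam sig \<psi>"
    unfolding linear_arb_policy_def
  proof (intro exI allI impI)
    fix y \<phi>
    show "let r = belief_rho lam sig \<phi> in
         \<psi> y \<phi> = (- B r 1 0 / (2 * A r)) * y + (- B r 0 1 / (2 * A r)) * belief_mean \<phi>"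
      unfolding Let_def \<psi>_def
      by (subst B_linear) (simp add: add_divide_distrib diff_divide_distrib)
  qed
  moreover have "is_arg_max (\<lambda>v. G_op lam sig \<pi> v V y \<phi>) (\<lambda>v. v \<in> UNIV) (\<psi> y \<phi>)"
    if gauss: "gaussian \<phi>" for y \<phi>
  proof -
    obtain m s where s: "s \<ge> 0" and \<phi>: "\<phi> = normal_belief m s"
      using gauss unfolding gaussian_iff by blast
    define r where "r = lam * s / sig"
    define k where "k = ay r * y + am r * m"
    define a where "a = ax r"
    \<comment> \<open>Here the actual trade is \<open>a * x + k\<close>, so the updated mean is
      \<open>p + q * x + h * e\<close>, random through both position and noise.\<close>
    define p where "p = k + (1 + a) * m / D r"
    define q where "q = (1 + a) * a\<^sup>2 * r\<^sup>2 / D r"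
    define h where "h = (1 + a) * a * r\<^sup>2 / (lam * D r)"
    have "D r > 0" by (simp add: D_def add_pos_nonneg)
    have u: "\<pi> x y \<phi> = a * x + k" for x
      by (simp add: \<phi> \<pi>[OF s] r_def k_def a_def)
    have upd: "bayes_update lam sig \<pi> y \<phi> v (lam * (a * x + k + v) + e)
        = normal_belief (p + q * x + h * e) (\<bar>1 + ax r\<bar> * (s / sqrt (D r)))" for x v e
    proof -
      have "k + (1 + a) * ((m + a * r\<^sup>2 * ((a * x + k) - k + e / lam)) / D r) = p + q * x + h * e"
        using \<open>D r > 0\<close> \<open>lam > 0\<close> unfolding p_def q_def h_def
        by (simp add: field_simps power2_eq_square)
      then show ?thesis
        using bayes_update_normal_belief[where \<pi> = \<pi> and y = y and m = m and a = a and k = k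
            and v = v and u = "a * x + k" and e = e, OF s \<open>sig > 0\<close> \<open>lam > 0\<close>] u
        by (simp add: \<phi> r_def[symmetric] D_def[symmetric] a_def)
    qed
    define M where "M = p + q * m"
    \<comment> \<open>The prior weight \<open>1 / D r\<close> and the signal weight
      \<open>a^2 * r^2 / D r\<close> sum to one, so the expected revision vanishes.\<close>
    have mean: "M = (1 + a) * m + k"
    proof -
      have "M = k + (1 + a) * m * ((1 + a\<^sup>2 * r\<^sup>2) / D r)"
        by (simp add: M_def p_def q_def add_divide_distrib algebra_simps)
      then show ?thesis
        using \<open>D r > 0\<close> by (simp add: D_def a_def)
    qed
    have r': "lam * (\<bar>1 + ax r\<bar> * (s / sqrt (D r))) / sig = r' r"
      by (simp add: r'_def r_def ac_simps)
    have s': "\<bar>1 + ax r\<bar> * (s / sqrt (D r)) \<ge> 0"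
      using s \<open>D r > 0\<close> by simp
    \<comment> \<open>The second moment of the updated mean.\<close>
    define W where "W = M\<^sup>2 + q\<^sup>2 * s\<^sup>2 + h\<^sup>2 * sig\<^sup>2"
    define K where "K = lam * (a * m + k) * y - lam * (dyy (r' r) * y\<^sup>2 / 2 + dmm (r' r) * W / 2
        + dym (r' r) * y * M - sig\<^sup>2 / lam\<^sup>2 * d0 (r' r))"
    have B: "B r y m = lam * y - lam * (dyy (r' r) * y + dym (r' r) * M)"
      by (simp add: B_def mean a_def k_def)
    have "G_op lam sig \<pi> v V y \<phi> = A r * v\<^sup>2 + B r y m * v + K" for v
    proof -
      define h0 where "h0 = lam * (k + v) * y
          - lam * (1/2 * dyy (r' r) * (y + v)\<^sup>2 - sig\<^sup>2 / lam\<^sup>2 * d0 (r' r))"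
      define h1 where "h1 = - lam * dym (r' r) * (y + v)"
      define h2 where "h2 = - lam * (1/2 * dmm (r' r))"
      have "G_op lam sig \<pi> v V y \<phi>
          = (\<integral>z. h0 + lam * a * y * fst z + h1 * (p + q * fst z + h * snd z)
               + h2 * (p + q * fst z + h * snd z)\<^sup>2 \<partial>(normal_belief m s \<Otimes>\<^sub>M normal_belief 0 sig))"
        unfolding G_op_def u Let_def upd V[OF s'] r' noise_eq_normal_belief[OF \<open>sig > 0\<close>]
        unfolding \<phi>
        by (rule Bochner_Integration.integral_cong)
          (simp_all add: h0_def h1_def h2_def case_prod_beta algebra_simps)
      also have "\<dots> = h0 + lam * a * y * m + h1 * M + h2 * W"
        unfolding W_def M_def using s \<open>sig > 0\<close> by (intro integral_pair_normal_belief_quadratic) simp_all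
      also have "\<dots> = A r * v\<^sup>2 + B r y m * v + K"
        by (simp add: h0_def h1_def h2_def K_def A_def B power2_eq_square add_divide_distrib algebra_simps)
      finally show ?thesis .
    qed
    from is_arg_max_quadratic[OF this] bdd gauss show ?thesis
      using s by (simp add: \<psi>_def \<phi> r_def)
  qed
  ultimately show "\<exists>\<psi>. linear_arb_policy lam sig \<psi> \<and>
           (\<forall>y \<phi>. gaussian \<phi> \<longrightarrow>
              is_arg_max (\<lambda>v. G_op lam sig \<pi> v V y \<phi>) (\<lambda>v. v \<in> UNIV) (\<psi> y \<phi>))"
    by blast
qed

end
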